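(* Let $q$ be odd and consider $f(X)=EX^2+CX^{2q}+DX^{2q^2}\in\mathbb{F}_q[X]$ with $C,D,E\in\mathbb{F}_q$. If $C^3+D^3+E^3-3CDE=2^{-1}$, then $f(X)$ is planar over $\mathbb{F}_{q^3}$.
   Context: $q$ is a power of an odd prime. For $q$ odd, a function $f:\mathbb{F}_{q^n}\to\mathbb{F}_{q^n}$ is called planar (over $\mathbb{F}_{q^n}$) if for every $\epsilon\in\mathbb{F}_{q^n}^*$ the polynomial $f(X+\epsilon)-f(X)$ induces a permutation of $\mathbb{F}_{q^n}$. *)

theory Defs
  imports
    "HOL-Library.Cardinality"
    "HOL-Number_Theory.Prime_Powers"
    "HOL-Algebra.Algebraic_Closure_Type"
begin

text \<open>The ambient finite field is the whole type \<open>'a\<close>.\<close>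

definition planar :: "('a::{field,finite} \<Rightarrow> 'a) \<Rightarrow> bool" where
  "planar f \<longleftrightarrow> (\<forall>\<epsilon>. \<epsilon> \<noteq> 0 \<longrightarrow> bij (\<lambda>x. f (x + \<epsilon>) - f x))"

end

theory Submission
  imports Defs "HOL-Number_Theory.Residues"
begin

text \<open>
  Write \<open>f(x) = L(x\<^sup>2)\<close> with \<open>L(y) = E y + C y\<^sup>q + D y\<^bsup>q\<^sup>2\<^esup>\<close> additive.  Then
  \<open>f(x + \<epsilon>) - f(x) = L(2 \<epsilon> x + \<epsilon>\<^sup>2)\<close>, so it suffices that \<open>L\<close> has trivial kernel.  If
  \<open>L(y) = 0\<close>, applying Frobenius twice gives a circulant linear system for
  \<open>(y, y\<^sup>q, y\<^bsup>q\<^sup>2\<^esup>)\<close> with determinant \<open>C\<^sup>3 + D\<^sup>3 + E\<^sup>3 - 3 C D E \<noteq> 0\<close>, hence \<open>y = 0\<close>.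
\<close>

text \<open>Multiplication by \<open>c\<close> is injective, hence permutes the finite set
  \<open>S\<close>. Comparing the product over \<open>S\<close> before and after gives a factor
  \<open>c ^ card S\<close>, and the nonzero product cancels.\<close>

lemma power_card_eq_1_of_mult_closed:
  fixes S :: "'a::field set"
  assumes "finite S" and "0 \<notin> S" and "c \<noteq> 0" and closed: "\<And>x. x \<in> S \<Longrightarrow> c * x \<in> S"
  shows "c ^ card S = 1"
proof -
  have inj: "inj_on ((*) c) S"
    using \<open>c \<noteq> 0\<close> by (auto simp: inj_on_def)
  moreover have "(*) c ` S \<subseteq> S"
    using closed by auto
  ultimately have "(*) c ` S = S"
    using \<open>finite S\<close> by (simp add: endo_inj_surj)
  then have "prod id S = prod ((*) c) S"
    using prod.reindex[OF inj, of id] by simp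
  then have "prod id S = c ^ card S * prod id S"
    by (simp add: prod.distrib)
  moreover have "prod id S \<noteq> 0"
    using assms by (auto simp: prod_zero_iff)
  ultimately show ?thesis by simp
qed

text \<open>Serves both fields at once: \<open>S = K\<close> yields \<open>c ^ q = c\<close>, and
  \<open>S = UNIV\<close> yields \<open>x ^ (q ^ 3) = x\<close>.\<close>

lemma power_card_eq_self_of_mult_closed:
  fixes S :: "'a::field set"
  assumes "finite S" and "0 \<in> S" and "c \<in> S" and closed: "\<And>x y. x \<in> S \<Longrightarrow> y \<in> S \<Longrightarrow> x * y \<in> S"
  shows "c ^ card S = c"
proof (cases "c = 0")
  case True
  then show ?thesis using assms by (auto simp: card_gt_0_iff)
next
  case False
  have "c ^ card (S - {0}) = 1"
    using assms False by (intro power_card_eq_1_of_mult_closed) auto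
  moreover have "card S = Suc (card (S - {0}))"
    using assms by (metis card_Suc_Diff1)
  ultimately show ?thesis by simp
qed

text \<open>Cramer's rule: the three multipliers in the proof are the cofactors of the first column
  of the coefficient matrix, so \<open>y\<close> and \<open>z\<close> drop out and the determinant
  remains in front of \<open>x\<close>.\<close>

lemma circulant_kernel_trivial:
  fixes C D E x y z :: "'a::field"
  assumes 1: "E * x + C * y + D * z = 0"
    and 2: "E * y + C * z + D * x = 0"
    and 3: "E * z + C * x + D * y = 0"
    and det: "C ^ 3 + D ^ 3 + E ^ 3 - 3 * C * D * E \<noteq> 0"
  shows "x = 0"
proof -
  have "(C ^ 3 + D ^ 3 + E ^ 3 - 3 * C * D * E) * x
      = (E * E - C * D) * (E * x + C * y + D * z)
      + (D * D - C * E) * (E * y + C * z + D * x)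
      + (C * C - D * E) * (E * z + C * x + D * y)"
    by (simp add: algebra_simps power3_eq_cube)
  then show ?thesis using assms by simp
qed

theorem theorem3p1:
  fixes q :: nat
    and K :: "'a::{field,finite} set"
    and C D E :: 'a
    and f :: "'a Polynomial.poly"
  assumes "primepow q" and "odd q"
    and "CARD('a) = q ^ 3"
    and "subfield K (ring_of_type_algebra :: 'a ring)" and "card K = q"
    and "C \<in> K" and "D \<in> K" and "E \<in> K"
    and "f = Polynomial.monom E 2 + Polynomial.monom C (2 * q) + Polynomial.monom D (2 * q ^ 2)"
    and "C ^ 3 + D ^ 3 + E ^ 3 - 3 * C * D * E = inverse 2"
  shows "planar (Polynomial.poly f)"
proof -
  obtain p k where p: "Factorial_Ring.prime p" "k > 0" "q = p ^ k"
    using \<open>primepow q\<close> by (auto simp: primepow_def)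
  have "CHAR('a) dvd p ^ (k * 3)"
    using CHAR_dvd_CARD[where 'a='a] assms(3) p by (simp add: power_mult)
  moreover have "Factorial_Ring.prime (CHAR('a))"
    by (rule prime_CHAR_semidom) (rule finite_imp_CHAR_pos, simp)
  ultimately have char: "CHAR('a) = p"
    using p(1) prime_dvd_power primes_dvd_imp_eq by blast
  have add: "(x + y) ^ q = x ^ q + y ^ q" for x y :: 'a
    by (rule freshmans_dream'[of q k]) (use p char in simp_all)
  have "odd p"
    using p \<open>odd q\<close> by simp
  \<comment> \<open>Needed twice: the determinant \<open>inverse 2\<close> must be nonzero
    (\<open>inverse 0\<close> is \<open>0\<close>), and the factor \<open>2 * \<epsilon>\<close>
    must cancel.\<close>
  have two: "(2::'a) \<noteq> 0"
  proof
    assume "(2::'a) = 0"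
    then have "p dvd 2"
      using of_nat_eq_0_iff_char_dvd[of 2, where 'a='a] char by simp
    then show False
      using \<open>odd p\<close> primes_dvd_imp_eq[OF p(1) two_is_prime_nat] by simp
  qed

  have K: "subring K (ring_of_type_algebra :: 'a ring)"
    by (rule subfieldE(1)) fact
  have fix_K: "c ^ q = c" if "c \<in> K" for c
  proof -
    have "c ^ card K = c"
      using that subringE(2,6)[OF K]
      by (intro power_card_eq_self_of_mult_closed) (auto simp: ring_of_type_algebra_def)
    then show ?thesis using \<open>card K = q\<close> by simp
  qed
  have cubed: "x ^ (q ^ 3) = x" for x :: 'a
    using power_card_eq_self_of_mult_closed[of UNIV x] assms(3) by simp

  define L where "L y = E * y + C * y ^ q + D * (y ^ q) ^ q" for y
  have kernel: "y = 0" if "L y = 0" for y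
  proof -
    \<comment> \<open>The coefficients lie in \<open>K\<close>, so the \<open>q\<close>-th power
      moves only the variables.\<close>
    have frob: "(E * u + C * v + D * w) ^ q = E * u ^ q + C * v ^ q + D * w ^ q" for u v w
      using fix_K assms(6-8) by (simp add: add power_mult_distrib)
    have zero: "(0::'a) ^ q = 0" using \<open>odd q\<close> by (simp add: odd_pos)
    \<comment> \<open>The third Frobenius iterate is the identity, so each application of
      \<open>frob\<close> permutes the three conjugates cyclically.\<close>
    have y: "((y ^ q) ^ q) ^ q = y"
      using cubed[of y] by (simp add: power_mult power3_eq_cube)
    have 1: "E * y + C * y ^ q + D * (y ^ q) ^ q = 0"
      using that by (simp add: L_def)
    then have 2: "E * y ^ q + C * (y ^ q) ^ q + D * y = 0"
      using frob[of y "y ^ q" "(y ^ q) ^ q"] y zero by simp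
    then have 3: "E * (y ^ q) ^ q + C * y + D * y ^ q = 0"
      using frob[of "y ^ q" "(y ^ q) ^ q" y] y zero by simp
    show ?thesis
      by (rule circulant_kernel_trivial[OF 1 2 3]) (unfold assms(10), use two in simp)
  qed
  have L_add: "L (x + y) = L x + L y" for x y
    by (simp add: L_def add algebra_simps)
  have f: "Polynomial.poly f x = L (x ^ 2)" for x
    by (simp add: assms(9) L_def Polynomial.poly_monom power_mult power2_eq_square[of q])

  show ?thesis
    unfolding planar_def
  proof (intro allI impI)
    fix \<epsilon> :: 'a assume "\<epsilon> \<noteq> 0"
    have diff: "Polynomial.poly f (x + \<epsilon>) - Polynomial.poly f x = L (2 * \<epsilon> * x + \<epsilon> ^ 2)" for x
    proof -
      have "(x + \<epsilon>) ^ 2 = x ^ 2 + (2 * \<epsilon> * x + \<epsilon> ^ 2)"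
        by (simp add: power2_eq_square algebra_simps)
      then show ?thesis by (simp add: f L_add)
    qed
    have "x = y" if "L (2 * \<epsilon> * x + \<epsilon> ^ 2) = L (2 * \<epsilon> * y + \<epsilon> ^ 2)" for x y
    proof -
      \<comment> \<open>The \<open>\<epsilon> ^ 2\<close> terms agree, so additivity isolates a
        kernel element proportional to \<open>x - y\<close>.\<close>
      have "L (2 * \<epsilon> * x + \<epsilon> ^ 2) = L (2 * \<epsilon> * (x - y)) + L (2 * \<epsilon> * y + \<epsilon> ^ 2)"
        by (simp add: L_add[symmetric] algebra_simps)
      then have "L (2 * \<epsilon> * (x - y)) = 0"
        using that by simp
      then have "2 * \<epsilon> * (x - y) = 0"
        by (rule kernel)
      then show ?thesis using \<open>\<epsilon> \<noteq> 0\<close> two by simp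
    qed
    then have "inj (\<lambda>x. Polynomial.poly f (x + \<epsilon>) - Polynomial.poly f x)"
      by (auto simp: inj_def diff)
    then show "bij (\<lambda>x. Polynomial.poly f (x + \<epsilon>) - Polynomial.poly f x)"
      by (simp add: bij_def finite_UNIV_inj_surj)
  qed
qed

end
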